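(* Every real globally balanced graph (real GB-graph) is locally balanced.
   Context: A cellularly embedded graph in a closed oriented surface is a finite graph embedded so that the complement is a finite union of simply connected open sets (faces). It is globally balanced of degree $d$ ($d\ge 2$) if it has $2d$ faces and admits an alternating 2-coloring of the faces (faces adjacent along an edge have different colors) with $d$ faces of each color. Real GB-graph: a globally balanced graph embedded in $\overline{\mathbb{C}}$ with all vertices in $\overline{\mathbb{R}}=\mathbb{R}\cup\{\infty\}$, with each face incident to the real line $\overline{\mathbb{R}}$ (the real line $\overline{\mathbb R}$ being contained in the graph, as the "real cycle"), and with the set of faces invariant under complex conjugation; more generally, a planar graph ambient isotopic to such a graph. Local balance. Let $\Gamma\subset S$ be a globally balanced graph with an alternating $A$-$B$ face coloring, with edges oriented so that $A$-faces lie on their left. A cycle of $\Gamma$ is a concatenation of edges forming a simple closed curve; it is positive if it keeps only $A$-faces on its left side. A collection $L=\{\gamma_1,\dots,\gamma_k\}$ of pairwise disjoint cycles is a cobordant multicycle if $S-\bigcup_n\gamma_n$ is disconnected and has a connected component $R$ with $\partial R=\bigsqcup_{n}\gamma_n$; it is positive if every $\gamma_n$ is positive, and its interior is then the connected component $R$ of $S-\bigcup_n\gamma_n$ with $\partial R=\bigsqcup_{n}\gamma_n$ lying on the left of the cycles (containing the $A$-faces incident to them). $\Gamma$ is locally balanced if for every positive cobordant multicycle the number of $A$-faces in its interior is strictly greater than the number of $B$-faces in its interior. (Here $S=\overline{\mathbb{C}}$.) *)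

theory Defs
  imports "HOL-Complex_Analysis.Complex_Analysis"
begin

text \<open>
  The Riemann sphere is modelled as the unit sphere of \<open>\<complex> \<times> \<real>\<close>. Stereographic projection from
  the north pole \<open>(0, 1)\<close>, which plays the role of infinity, sends \<open>(u, t)\<close> to \<open>u / (1 - t)\<close>.
  Under this identification the extended real line is the great circle \<open>Im u = 0\<close> and complex
  conjugation is \<open>(u, t) \<mapsto> (cnj u, t)\<close>.
\<close>

type_synonym point = "complex \<times> real"

definition riemann_sphere :: "point set" where
  "riemann_sphere = sphere 0 1"

definition real_line :: "point set" where
  "real_line = {(u, t). (u, t) \<in> riemann_sphere \<and> Im u = 0}"

definition conj_point :: "point \<Rightarrow> point" where
  "conj_point = (\<lambda>(u, t). (cnj u, t))"

text \<open>
  Edges are closed subsets of the sphere (arcs or loops) that meet the vertex set exactly in their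
  end points. Multiple edges and loops are allowed.
\<close>

definition embedded_graph :: "point set \<Rightarrow> point set set \<Rightarrow> bool" where
  "embedded_graph V E \<longleftrightarrow>
     finite V \<and> finite E \<and> V \<subseteq> riemann_sphere \<and>
     (\<forall>e\<in>E. e \<subseteq> riemann_sphere \<and>
        (\<exists>g. simple_path g \<and> path_image g = e \<and> e \<inter> V = {pathstart g, pathfinish g})) \<and>
     (\<forall>e\<in>E. \<forall>f\<in>E. e \<noteq> f \<longrightarrow> e \<inter> f \<subseteq> V)"

definition faces :: "point set \<Rightarrow> point set set \<Rightarrow> point set set" where
  "faces V E = components (riemann_sphere - (V \<union> \<Union>E))"

definition cellularly_embedded :: "point set \<Rightarrow> point set set \<Rightarrow> bool" where
  "cellularly_embedded V E \<longleftrightarrow>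
     embedded_graph V E \<and> finite (faces V E) \<and> (\<forall>F\<in>faces V E. simply_connected F)"

definition incident :: "point set \<Rightarrow> point set \<Rightarrow> bool" where
  "incident e F \<longleftrightarrow> e \<subseteq> closure F"

text \<open>
  The faces on the two sides of every edge carry different colours. In particular no edge has the
  same face on both sides.
\<close>

definition alternating_colouring ::
    "point set \<Rightarrow> point set set \<Rightarrow> point set set \<Rightarrow> point set set \<Rightarrow> bool" where
  "alternating_colouring V E A B \<longleftrightarrow>
     A \<union> B = faces V E \<and> A \<inter> B = {} \<and>
     (\<forall>e\<in>E. \<exists>F\<in>A. \<exists>G\<in>B. {H \<in> faces V E. incident e H} = {F, G})"

definition globally_balanced :: "nat \<Rightarrow> point set \<Rightarrow> point set set \<Rightarrow> bool" where
  "globally_balanced d V E \<longleftrightarrow>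
     d \<ge> 2 \<and> cellularly_embedded V E \<and> card (faces V E) = 2 * d \<and>
     (\<exists>A B. alternating_colouring V E A B \<and> card A = d \<and> card B = d)"

text \<open>
  A face is incident to the real line if an edge of the real cycle lies on its boundary. (Touching
  the real line in a vertex is no restriction, since all vertices are real.)
\<close>

definition real_gb_standard :: "nat \<Rightarrow> point set \<Rightarrow> point set set \<Rightarrow> bool" where
  "real_gb_standard d V E \<longleftrightarrow>
     globally_balanced d V E \<and> V \<subseteq> real_line \<and>
     (\<exists>C\<subseteq>E. \<Union>C = real_line) \<and>
     (\<forall>F\<in>faces V E. \<exists>e\<in>E. e \<subseteq> real_line \<and> incident e F) \<and>
     (\<lambda>F. conj_point ` F) ` faces V E = faces V E"

definition ambient_isotopic ::
    "point set \<Rightarrow> point set set \<Rightarrow> point set \<Rightarrow> point set set \<Rightarrow> bool" where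
  "ambient_isotopic V E V' E' \<longleftrightarrow>
     (\<exists>h :: real \<times> point \<Rightarrow> point.
        continuous_on ({0..1} \<times> riemann_sphere) h \<and>
        (\<forall>s\<in>{0..1}. \<exists>g. homeomorphism riemann_sphere riemann_sphere (\<lambda>x. h (s, x)) g) \<and>
        (\<forall>x\<in>riemann_sphere. h (0, x) = x) \<and>
        (\<lambda>x. h (1, x)) ` V = V' \<and>
        (\<lambda>e. (\<lambda>x. h (1, x)) ` e) ` E = E')"

definition real_gb_graph :: "nat \<Rightarrow> point set \<Rightarrow> point set set \<Rightarrow> bool" where
  "real_gb_graph d V E \<longleftrightarrow>
     (\<exists>V0 E0. real_gb_standard d V0 E0 \<and> ambient_isotopic V0 E0 V E)"

text \<open>
  Homogeneous coordinates \<open>[a : b]\<close> with \<open>a / b = u / (1 - t)\<close>. Up to a nonzero constant factor,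
  \<open>cross_map z w x\<close> is \<open>(x - z) / (x - w)\<close> in the affine coordinate, i.e. a Moebius map sending
  \<open>z\<close> to 0 and \<open>w\<close> to infinity.
\<close>

definition hom_coords :: "point \<Rightarrow> complex \<times> complex" where
  "hom_coords = (\<lambda>(u, t). if t = 1 then (1, 0) else (u, of_real (1 - t)))"

definition hom_det :: "point \<Rightarrow> point \<Rightarrow> complex" where
  "hom_det x y = fst (hom_coords x) * snd (hom_coords y) - snd (hom_coords x) * fst (hom_coords y)"

definition cross_map :: "point \<Rightarrow> point \<Rightarrow> point \<Rightarrow> complex" where
  "cross_map z w x = hom_det x z / hom_det x w"

text \<open>
  For an oriented simple closed curve \<open>p\<close> on the sphere, the winding number below is 1, -1 or 0
  according to whether \<open>z\<close> is on the left and \<open>w\<close> on the right of \<open>p\<close>, vice versa, or both are on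
  the same side.
\<close>

definition left_side :: "(real \<Rightarrow> point) \<Rightarrow> point set" where
  "left_side p = {z \<in> riemann_sphere - path_image p.
     \<exists>w \<in> riemann_sphere - path_image p. winding_number (cross_map z w \<circ> p) 0 = 1}"

definition oriented_cycle :: "point set set \<Rightarrow> (real \<Rightarrow> point) \<Rightarrow> bool" where
  "oriented_cycle E p \<longleftrightarrow>
     simple_path p \<and> pathfinish p = pathstart p \<and> (\<exists>C\<subseteq>E. path_image p = \<Union>C)"

definition positive_cycle ::
    "point set \<Rightarrow> point set set \<Rightarrow> point set set \<Rightarrow> (real \<Rightarrow> point) \<Rightarrow> bool" where
  "positive_cycle V E A p \<longleftrightarrow>
     oriented_cycle E p \<and>
     (\<forall>F\<in>faces V E. F \<subseteq> left_side p \<and> (\<exists>e\<in>E. e \<subseteq> path_image p \<and> incident e F) \<longrightarrow> F \<in> A)"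

definition bounded_region :: "(real \<Rightarrow> point) set \<Rightarrow> point set \<Rightarrow> bool" where
  "bounded_region L R \<longleftrightarrow>
     R \<in> components (riemann_sphere - (\<Union>p\<in>L. path_image p)) \<and>
     top_of_set riemann_sphere frontier_of R = (\<Union>p\<in>L. path_image p)"

definition cobordant_multicycle :: "point set set \<Rightarrow> (real \<Rightarrow> point) set \<Rightarrow> bool" where
  "cobordant_multicycle E L \<longleftrightarrow>
     finite L \<and> (\<forall>p\<in>L. oriented_cycle E p) \<and>
     pairwise (\<lambda>p q. disjnt (path_image p) (path_image q)) L \<and>
     \<not> connected (riemann_sphere - (\<Union>p\<in>L. path_image p)) \<and>
     (\<exists>R. bounded_region L R)"

definition positive_multicycle ::
    "point set \<Rightarrow> point set set \<Rightarrow> point set set \<Rightarrow> (real \<Rightarrow> point) set \<Rightarrow> bool" where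
  "positive_multicycle V E A L \<longleftrightarrow>
     cobordant_multicycle E L \<and> (\<forall>p\<in>L. positive_cycle V E A p)"

definition interior_region :: "(real \<Rightarrow> point) set \<Rightarrow> point set \<Rightarrow> bool" where
  "interior_region L R \<longleftrightarrow> bounded_region L R \<and> (\<forall>p\<in>L. R \<subseteq> left_side p)"

text \<open>
  The alternating colouring of a globally balanced graph is unique up to exchanging the two colours;
  the inequality is required for both choices.
\<close>

definition locally_balanced :: "point set \<Rightarrow> point set set \<Rightarrow> bool" where
  "locally_balanced V E \<longleftrightarrow>
     (\<exists>d. globally_balanced d V E) \<and>
     (\<forall>A B L R. alternating_colouring V E A B \<and> positive_multicycle V E A L \<and>
        interior_region L R \<longrightarrow>
        card {F \<in> A. F \<subseteq> R} > card {F \<in> B. F \<subseteq> R})"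

end

theory Submission
  imports Defs
begin

text \<open>
  After an ambient isotopy, complex conjugation becomes an involution \<open>c\<close> of the sphere that permutes
  the faces. A face \<open>F\<close> and \<open>c F\<close> are the two sides of a common real edge, so \<open>c\<close> exchanges the
  colours. Let \<open>R\<close> be the interior of a positive multicycle; by positivity, the faces in \<open>R\<close> along its
  boundary are \<open>A\<close>-faces. Hence for a \<open>B\<close>-face \<open>F\<close> in \<open>R\<close> the real edge separating \<open>F\<close> from \<open>c F\<close> is
  not on the boundary of \<open>R\<close>, so that \<open>c F\<close> is in \<open>R\<close> as well, and \<open>F \<mapsto> c F\<close> injects the \<open>B\<close>-faces of
  \<open>R\<close> into its \<open>A\<close>-faces. If this were onto, consider an edge of the boundary with \<open>F\<close> on its inner and
  \<open>G\<close> on its outer side: \<open>c F\<close> is in \<open>R\<close> but \<open>c G\<close> is not, so the \<open>B\<close>-face \<open>c F\<close> lies along the boundary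
  of \<open>R\<close>, which is impossible.

  The topological input is that a face which touches an edge of a cycle \<open>J\<close> at an inner point contains
  the whole edge in its closure. By the Jordan curve theorem, among this face and the two sides of the
  edge, two lie on the same side of \<open>J\<close>; with \<open>Y\<close> the graph without the open edge, \<open>J \<inter> Y\<close> is connected,
  and by Janiszewski's theorem these two are not separated by \<open>J \<union> Y\<close>.
\<close>

section \<open>Jordan curves\<close>

text \<open>Since the base point is outside \<open>Q\<close>, the parameters mapped into
  \<open>Q\<close> form an interval inside the open unit interval. The two remaining end intervals
  of parameters have connected images, which are glued at the common value
  \<open>p 0 = p 1\<close>.\<close>

lemma loop_minus_connected_start:
  fixes p :: "real \<Rightarrow> 'a::metric_space"
  assumes p: "simple_path p" "pathfinish p = pathstart p"
    and Q: "connected Q" "Q \<subseteq> path_image p" "pathstart p \<notin> Q"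
  shows "connected (path_image p - Q)"
proof -
  have cont: "continuous_on {0..1} p"
    using p(1) by (simp add: simple_path_def path_def)
  have loop_free: "s = t \<or> s = 0 \<and> t = 1 \<or> s = 1 \<and> t = 0"
    if "s \<in> {0..1}" "t \<in> {0..1}" "p s = p t" for s t
    using p(1) that unfolding simple_path_def loop_free_def by blast
  have ends: "p 0 \<notin> Q" "p 1 \<notin> Q"
    using p(2) Q(3) by (auto simp: pathstart_def pathfinish_def)
  \<comment> \<open>The set of parameters mapped into \<open>Q\<close> is convex: a parameter
    \<open>t\<close> outside it, between two of its members, would cut the connected set
    \<open>Q\<close> into two nonempty relatively closed pieces.\<close>
  have between: "p t \<in> Q" if "p s \<in> Q" "p u \<in> Q" "0 \<le> s" "s < t" "t < u" "u \<le> 1" for s t u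
  proof (rule ccontr)
    assume "p t \<notin> Q"
    have "continuous_on {0..t} p" "continuous_on {t..1} p"
      using that by (auto intro: continuous_on_subset [OF cont])
    then have closed: "closed (p ` {0..t})" "closed (p ` {t..1})"
      by (auto intro!: compact_imp_closed compact_continuous_image)
    have "Q \<subseteq> p ` {0..t} \<union> p ` {t..1}"
    proof
      fix x assume "x \<in> Q"
      then obtain r where "r \<in> {0..1}" "x = p r"
        using Q(2) by (auto simp: path_image_def)
      then show "x \<in> p ` {0..t} \<union> p ` {t..1}"
        by (cases "r \<le> t") auto
    qed
    \<comment> \<open>By loop freeness the two subarcs share only \<open>p t\<close> and the base
      point, and neither of these is in \<open>Q\<close>.\<close>
    moreover have "p ` {0..t} \<inter> p ` {t..1} \<inter> Q = {}"
    proof -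
      have "p r \<notin> Q" if r: "r \<in> {0..t}" "r' \<in> {t..1}" "p r = p r'" for r r'
      proof -
        have "r = r' \<or> r = 0 \<and> r' = 1 \<or> r = 1 \<and> r' = 0"
          by (rule loop_free) (use r \<open>0 \<le> s\<close> \<open>s < t\<close> \<open>t < u\<close> \<open>u \<le> 1\<close> in auto)
        then show ?thesis
          using r ends \<open>p t \<notin> Q\<close> by (metis antisym atLeastAtMost_iff)
      qed
      then show ?thesis by fastforce
    qed
    moreover have "p ` {0..t} \<inter> Q \<noteq> {}" "p ` {t..1} \<inter> Q \<noteq> {}"
      using that by (auto simp: disjoint_iff intro: bexI [of _ s] bexI [of _ u])
    ultimately show False
      using connected_closedD [OF Q(1)] closed by blast
  qed
  \<comment> \<open>The parameters before and after all of \<open>Q\<close>. By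
    \<open>between\<close>, every parameter mapped outside \<open>Q\<close> is of one of these
    kinds.\<close>
  define L where "L = {t\<in>{0..1}. \<forall>i\<in>{0..1}. p i \<in> Q \<longrightarrow> t < i}"
  define U where "U = {t\<in>{0..1}. \<forall>i\<in>{0..1}. p i \<in> Q \<longrightarrow> i < t}"
  have "connected L" "connected U"
    unfolding L_def U_def
    by (rule is_interval_connected; force simp: is_interval_1)+
  moreover have sub: "L \<subseteq> {0..1}" "U \<subseteq> {0..1}"
    by (auto simp: L_def U_def)
  ultimately have "connected (p ` L)" "connected (p ` U)"
    by (meson connected_continuous_image cont continuous_on_subset)+
  moreover have "0 \<in> L" "1 \<in> U"
    using ends by (auto simp: L_def U_def order_less_le)
  then have "p 0 \<in> p ` L \<inter> p ` U"
    using p(2) by (metis IntI imageI pathfinish_def pathstart_def)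
  ultimately have "connected (p ` L \<union> p ` U)"
    by (metis connected_Un emptyE)
  moreover have "path_image p - Q = p ` L \<union> p ` U"
  proof
    show "path_image p - Q \<subseteq> p ` L \<union> p ` U"
    proof
      fix x assume "x \<in> path_image p - Q"
      then obtain t where t: "t \<in> {0..1}" "x = p t" "p t \<notin> Q"
        by (auto simp: path_image_def)
      have "t \<in> L \<union> U"
      proof (rule ccontr)
        assume "t \<notin> L \<union> U"
        then obtain i j where "i \<in> {0..1}" "p i \<in> Q" "i \<le> t" "j \<in> {0..1}" "p j \<in> Q" "t \<le> j"
          using t(1) unfolding L_def U_def by force
        then show False
          using between [of i j t] t(3) by (metis atLeastAtMost_iff order_less_le)
      qed
      then show "x \<in> p ` L \<union> p ` U" using t(2) by blast
    qed
    show "p ` L \<union> p ` U \<subseteq> path_image p - Q"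
      unfolding L_def U_def path_image_def by force
  qed
  ultimately show ?thesis by simp
qed

text \<open>A proper subset misses some point of the loop; \<open>shiftpath\<close> moves the base
  point there.\<close>

lemma loop_minus_connected:
  fixes p :: "real \<Rightarrow> 'a::metric_space"
  assumes p: "simple_path p" "pathfinish p = pathstart p"
    and Q: "connected Q" "Q \<subset> path_image p"
  shows "connected (path_image p - Q)"
proof -
  obtain a where a: "a \<in> {0..1}" "p a \<notin> Q"
    using Q(2) unfolding path_image_def by blast
  have im: "path_image (shiftpath a p) = path_image p"
    using a p by (simp add: path_image_shiftpath)
  have "connected (path_image (shiftpath a p) - Q)"
  proof (rule loop_minus_connected_start)
    show "simple_path (shiftpath a p)"
      using a p by (simp add: simple_path_shiftpath)
    show "pathfinish (shiftpath a p) = pathstart (shiftpath a p)"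
      using a p by (simp add: closed_shiftpath)
    show "pathstart (shiftpath a p) \<notin> Q"
      using a by (simp add: pathstart_shiftpath)
  qed (use Q im in auto)
  then show ?thesis by (simp add: im)
qed

text \<open>Janiszewski's theorem: neither compact \<open>J\<close> nor closed \<open>Y\<close>
  alone separates \<open>x\<close> from \<open>y\<close>, and their intersection is connected. The
  set \<open>D\<close> joins the two points off \<open>J\<close>, and \<open>A\<close> and
  \<open>B\<close> joined through their common limit point \<open>z\<close> do so off
  \<open>Y\<close>.\<close>

lemma connected_component_across_loop:
  fixes J Y :: "complex set"
  assumes J: "compact J" and Y: "closed Y" "connected (J \<inter> Y)" and z: "z \<notin> Y"
    and D: "connected D" "D \<inter> J = {}"
    and A: "connected A" "A \<inter> Y = {}" "A \<subseteq> D" "z \<in> closure A" "x \<in> A"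
    and B: "connected B" "B \<inter> Y = {}" "B \<subseteq> D" "z \<in> closure B" "y \<in> B"
  shows "connected_component (- (J \<union> Y)) x y"
proof (rule Janiszewski [OF J Y])
  show "connected_component (- J) x y"
    unfolding connected_component_def using A B D by (intro exI [of _ D]) auto
  have "connected (insert z A)" "connected (insert z B)"
    using A(1,4) B(1,4) closure_subset [of A] closure_subset [of B]
    by (metis connected_intermediate_closure insert_subset subset_insertI)+
  then have "connected (insert z A \<union> insert z B)"
    by (intro connected_Un) auto
  then show "connected_component (- Y) x y"
    unfolding connected_component_def using A B z
    by (intro exI [of _ "insert z A \<union> insert z B"]) auto
qed

text \<open>Each member of the family is connected and misses the Jordan curve, so it lies inside or
  outside. With more than two members, two share a side, and that side serves as \<open>D\<close> in
  \<open>connected_component_across_loop\<close>.\<close>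

lemma sets_at_loop_point:
  fixes p :: "real \<Rightarrow> complex"
  defines "J \<equiv> path_image p"
  assumes p: "simple_path p" "pathfinish p = pathstart p"
    and Y: "closed Y" "connected (J \<inter> Y)" and z: "z \<notin> Y"
    and \<F>: "\<And>A. A \<in> \<F> \<Longrightarrow> connected A \<and> A \<inter> (J \<union> Y) = {} \<and> z \<in> closure A"
    and card: "card \<F> > 2"
  shows "\<exists>A\<in>\<F>. \<exists>B\<in>\<F>. A \<noteq> B \<and> (\<forall>x\<in>A. \<forall>y\<in>B. connected_component (- (J \<union> Y)) x y)"
proof -
  have jordan: "inside J \<union> outside J = - J" "inside J \<inter> outside J = {}"
      "open (inside J)" "open (outside J)" "connected (inside J)" "connected (outside J)"
    using Jordan_inside_outside [OF p] unfolding J_def by simp_all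
  have side: "A \<subseteq> inside J \<or> A \<subseteq> outside J" if "A \<in> \<F>" for A
    using \<F> [OF that] jordan connectedD [of A "inside J" "outside J"] by blast
  \<comment> \<open>The pigeonhole principle, with the two truth values standing for the two sides
    of \<open>J\<close>.\<close>
  have "card ((\<lambda>A. A \<subseteq> inside J) ` \<F>) \<le> card (UNIV :: bool set)"
    by (rule card_mono) auto
  then have "\<not> inj_on (\<lambda>A. A \<subseteq> inside J) \<F>"
    using card pigeonhole [of "\<lambda>A. A \<subseteq> inside J" \<F>] by simp
  then obtain A B where AB: "A \<in> \<F>" "B \<in> \<F>" "A \<noteq> B" "A \<subseteq> inside J \<longleftrightarrow> B \<subseteq> inside J"
    by (auto simp: inj_on_def)
  then obtain D where D: "A \<subseteq> D" "B \<subseteq> D" "connected D" "D \<inter> J = {}"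
  proof (cases "A \<subseteq> inside J")
    case True
    then show ?thesis using AB(4) jordan that [of "inside J"] inside_no_overlap by blast
  next
    case False
    then show ?thesis using AB side jordan that [of "outside J"] outside_no_overlap by blast
  qed
  have "compact J"
    using p by (simp add: J_def compact_simple_path_image)
  have A: "connected A" "A \<inter> Y = {}" "z \<in> closure A"
    and B: "connected B" "B \<inter> Y = {}" "z \<in> closure B"
    using \<F> [OF AB(1)] \<F> [OF AB(2)] by blast+
  have "connected_component (- (J \<union> Y)) x y" if "x \<in> A" "y \<in> B" for x y
    using connected_component_across_loop [OF \<open>compact J\<close> Y z D(3,4) A(1,2) D(1) A(3) that(1)
        B(1,2) D(2) B(3) that(2)] .
  then have "A \<noteq> B \<and> (\<forall>x\<in>A. \<forall>y\<in>B. connected_component (- (J \<union> Y)) x y)"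
    using AB(3) by simp
  then show ?thesis
    by (rule bexI [OF bexI [OF _ AB(2)] AB(1)])
qed

section \<open>Faces at an edge of a cycle\<close>

text \<open>This carries questions on the sphere to the plane, where the Jordan curve theorem and
  Janiszewski's theorem are stated.\<close>

lemma punctured_riemann_sphere:
  assumes "q \<in> riemann_sphere"
  obtains f g where "homeomorphism (riemann_sphere - {q}) (UNIV :: complex set) f g"
proof -
  have "(sphere (0::point) 1 - {q}) homeomorphic (UNIV :: complex set)"
    using assms by (intro homeomorphic_punctured_sphere_affine) (auto simp: riemann_sphere_def)
  then show ?thesis
    using that by (auto simp: homeomorphic_def riemann_sphere_def)
qed

lemma closure_image_continuous:
  fixes f :: "'a::metric_space \<Rightarrow> 'b::metric_space"
  assumes "continuous_on T f" "A \<subseteq> T" "z \<in> T" "z \<in> closure A"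
  shows "f z \<in> closure (f ` A)"
proof -
  obtain x where x: "\<And>n. x n \<in> A" "x \<longlonglongrightarrow> z"
    using assms(4) by (auto simp: closure_sequential)
  then have "(f \<circ> x) \<longlonglongrightarrow> f z"
    using assms unfolding continuous_on_sequentially by blast
  then show ?thesis
    using x(1) unfolding closure_sequential by (intro exI [of _ "f \<circ> x"]) auto
qed

section \<open>Elementary facts about embedded graphs and their faces\<close>

lemma embedded_graph_edgeE:
  assumes "embedded_graph V E" "e \<in> E"
  obtains g where "simple_path g" "path_image g = e" "e \<inter> V = {pathstart g, pathfinish g}"
proof -
  have "\<exists>g. simple_path g \<and> path_image g = e \<and> e \<inter> V = {pathstart g, pathfinish g}"
    using assms by (simp add: embedded_graph_def)
  then show ?thesis using that by (elim exE conjE)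
qed

lemma embedded_graph_edges_meet:
  assumes "embedded_graph V E" "e \<in> E" "f \<in> E" "e \<noteq> f"
  shows "e \<inter> f \<subseteq> V"
  using assms by (simp add: embedded_graph_def)

lemma embedded_graph_edge_compact:
  assumes "embedded_graph V E" "e \<in> E"
  shows "compact e"
  using embedded_graph_edgeE [OF assms] compact_simple_path_image by metis

lemma embedded_graph_compact:
  assumes "embedded_graph V E" "E' \<subseteq> E"
  shows "compact (V \<union> \<Union>E')"
proof (rule compact_Un [OF finite_imp_compact compact_Union])
  show "finite V" "finite E'"
    using assms finite_subset by (auto simp: embedded_graph_def)
  show "compact e" if "e \<in> E'" for e
    using embedded_graph_edge_compact [OF assms(1)] assms(2) that by blast
qed

lemma faceD:
  assumes "F \<in> faces V E"
  shows "F \<subseteq> riemann_sphere" "F \<inter> (V \<union> \<Union>E) = {}" "connected F" "F \<noteq> {}"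
  using assms in_components_subset in_components_connected in_components_nonempty
  unfolding faces_def by blast+

lemma component_eq_connected_component_set:
  assumes "C \<in> components S" "x \<in> C"
  shows "C = connected_component_set S x"
  using assms connected_component_eq unfolding components_iff by blast

lemma faces_eqI:
  assumes "F \<in> faces V E" "G \<in> faces V E" "x \<in> F" "y \<in> G"
    and "connected_component (riemann_sphere - (V \<union> \<Union>E)) x y"
  shows "F = G"
proof -
  let ?S = "riemann_sphere - (V \<union> \<Union>E)"
  have "F = connected_component_set ?S x" "G = connected_component_set ?S y"
    using assms(1-4) unfolding faces_def by (simp_all add: component_eq_connected_component_set)
  then show ?thesis
    using connected_component_eq [of y ?S x] assms(5) by simp
qed

lemma faces_eq_if_meet:
  assumes "F \<in> faces V E" "G \<in> faces V E" "F \<inter> G \<noteq> {}"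
  shows "F = G"
  using assms unfolding faces_def by (meson components_eq)

text \<open>Otherwise \<open>H\<close> is a third face at \<open>z\<close>, besides the two faces
  \<open>F\<close> and \<open>G\<close> that the colouring places along \<open>e\<close>. By
  \<open>sets_at_loop_point\<close>, two of the three are connected to each other off the graph,
  although distinct faces are distinct components.\<close>

lemma incident_if_touches_cycle_edge:
  assumes gr: "embedded_graph V E" and col: "alternating_colouring V E A B"
    and card: "card (faces V E) > 3"
    and p: "simple_path p" "pathfinish p = pathstart p" "path_image p \<subseteq> \<Union>E"
    and e: "e \<in> E" "e \<subseteq> path_image p" and z: "z \<in> e - V"
    and H: "H \<in> faces V E" "z \<in> closure H"
  shows "incident e H"
proof (rule ccontr)
  assume not_inc: "\<not> incident e H"
  obtain F G where FG: "F \<in> A" "G \<in> B" "{H \<in> faces V E. incident e H} = {F, G}"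
    using col e unfolding alternating_colouring_def by blast
  then have FG': "F \<in> faces V E" "G \<in> faces V E" "incident e F" "incident e G"
    by blast+
  have "F \<noteq> G" "H \<noteq> F" "H \<noteq> G"
    using FG col not_inc FG' unfolding alternating_colouring_def by auto
  then have card3: "card {F, G, H} = 3" by auto
  have faces: "{F, G, H} \<subseteq> faces V E" using FG' H by auto
  \<comment> \<open>A fourth face supplies the puncture \<open>q\<close>: the sphere without
    \<open>q\<close> still contains the graph and all of \<open>F\<close>, \<open>G\<close>,
    \<open>H\<close>, and it is homeomorphic to the plane.\<close>
  have "\<exists>K\<in>faces V E. K \<notin> {F, G, H}"
  proof (rule ccontr)
    assume "\<not> (\<exists>K\<in>faces V E. K \<notin> {F, G, H})"
    then have "card (faces V E) \<le> card {F, G, H}" by (intro card_mono) auto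
    then show False using card card3 by simp
  qed
  then obtain K q where K: "K \<in> faces V E" "K \<notin> {F, G, H}" "q \<in> K"
    using faceD(4) by blast
  define X where "X = V \<union> \<Union>E"
  \<comment> \<open>The graph without the open edge \<open>e - V\<close>, so that \<open>J\<close>
    and \<open>Y\<close> together make up the graph \<open>X\<close>.\<close>
  define Y where "Y = V \<union> \<Union>(E - {e})"
  define J where "J = path_image p"
  define T where "T = riemann_sphere - {q}"
  have q: "q \<in> riemann_sphere" "q \<notin> X" "q \<notin> F" "q \<notin> G" "q \<notin> H"
  proof -
    show "q \<in> riemann_sphere" "q \<notin> X"
      using K faceD(1,2) [OF K(1)] unfolding X_def by blast+
    show "q \<notin> F" "q \<notin> G" "q \<notin> H"
      using K(2,3) faces_eq_if_meet [OF K(1)] faces by blast+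
  qed
  obtain f g where fg: "homeomorphism T (UNIV :: complex set) f g"
    using punctured_riemann_sphere [OF q(1)] unfolding T_def .
  have contf: "continuous_on T f" and injf: "inj_on f T"
    using fg unfolding homeomorphism_def by (auto intro: inj_on_inverseI)
  have X: "X \<subseteq> T"
    using gr q by (auto simp: X_def T_def embedded_graph_def)
  have XJY: "X = J \<union> Y"
    using e p(3) by (auto simp: X_def J_def Y_def)
  have fT: "A \<subseteq> T" if "A \<in> {F, G, H}" for A
    using that faceD(1) faces q by (auto simp: T_def)
  obtain k where k: "simple_path k" "path_image k = e" "e \<inter> V = {pathstart k, pathfinish k}"
    using embedded_graph_edgeE [OF gr e(1)] .
  have eV: "e - V = path_image k - {pathstart k, pathfinish k}"
    using k by auto
  have "e \<inter> e' \<subseteq> V" if "e' \<in> E" "e' \<noteq> e" for e'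
    using embedded_graph_edges_meet [OF gr e(1)] that by blast
  then have eY: "(e - V) \<inter> Y = {}"
    unfolding Y_def by blast
  then have zY: "z \<notin> Y" using z by blast
  have "X = Y \<union> (e - V)"
    using e(1) unfolding X_def Y_def by blast
  then have JY: "J \<inter> Y = J - (e - V)"
    using eY XJY by blast
  \<comment> \<open>The intersection of \<open>J\<close> and \<open>Y\<close> is the loop with the
    open edge removed. The open edge is a proper subset of the loop because it lacks its end
    points.\<close>
  have "connected (J - (e - V))"
    unfolding J_def
  proof (rule loop_minus_connected [OF p(1,2)])
    show "connected (e - V)"
      unfolding eV by (rule connected_simple_path_endless [OF k(1)])
    show "e - V \<subset> path_image p"
      using e k by blast
  qed
  then have "connected (f ` (J \<inter> Y))"
    using connected_continuous_image [OF continuous_on_subset [OF contf]] X XJY JY by auto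
  moreover have imJ: "path_image (f \<circ> p) = f ` J"
    by (simp add: J_def path_image_compose)
  moreover have "f ` (J \<inter> Y) = f ` J \<inter> f ` Y"
    using inj_on_image_Int [OF injf] X XJY by auto
  ultimately have conn: "connected (path_image (f \<circ> p) \<inter> f ` Y)" by simp
  have "compact Y"
    unfolding Y_def by (rule embedded_graph_compact [OF gr]) auto
  then have closed: "closed (f ` Y)"
    using X XJY by (intro compact_imp_closed compact_continuous_image continuous_on_subset [OF contf]) auto
  have zT: "z \<in> T" using z e X by (auto simp: X_def)
  have fz: "f z \<notin> f ` Y"
    using inj_on_image_mem_iff [OF injf zT, of Y] X XJY zY by auto
  have "\<exists>A'\<in>(`) f ` {F, G, H}. \<exists>B'\<in>(`) f ` {F, G, H}. A' \<noteq> B' \<and>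
     (\<forall>x\<in>A'. \<forall>y\<in>B'. connected_component (- (path_image (f \<circ> p) \<union> f ` Y)) x y)"
  proof (rule sets_at_loop_point [OF _ _ closed conn fz])
    show "simple_path (f \<circ> p)"
      using p X XJY injf
      by (intro simple_path_continuous_image continuous_on_subset [OF contf])
        (auto simp: J_def intro: inj_on_subset)
    show "pathfinish (f \<circ> p) = pathstart (f \<circ> p)"
      using p by (simp add: pathfinish_def pathstart_def)
    have "inj_on ((`) f) {F, G, H}"
      using fT by (intro inj_on_image inj_on_subset [OF injf]) auto
    then show "2 < card ((`) f ` {F, G, H})"
      using card3 by (simp only: card_image)
    fix A' assume "A' \<in> (`) f ` {F, G, H}"
    then obtain M where M: "M \<in> {F, G, H}" "A' = f ` M" by blast
    have MT: "M \<subseteq> T" and face: "M \<in> faces V E" using fT [OF M(1)] M(1) faces by auto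
    have "connected A'"
      unfolding M by (rule connected_continuous_image [OF continuous_on_subset [OF contf MT] faceD(3) [OF face]])
    moreover have "A' \<inter> (path_image (f \<circ> p) \<union> f ` Y) = {}"
    proof -
      have "f ` M \<inter> f ` X = f ` (M \<inter> X)"
        using inj_on_image_Int [OF injf MT X] by simp
      also have "M \<inter> X = {}" using faceD(2) [OF face] by (simp add: X_def)
      finally show ?thesis by (simp add: M imJ XJY image_Un)
    qed
    moreover have "z \<in> closure M"
      using M(1) H z FG' by (auto simp: incident_def)
    then have "f z \<in> closure A'"
      unfolding M by (rule closure_image_continuous [OF contf MT zT])
    ultimately show "connected A' \<and> A' \<inter> (path_image (f \<circ> p) \<union> f ` Y) = {} \<and> f z \<in> closure A'"
      by blast
  qed
  then obtain A' B' where A': "A' \<in> (`) f ` {F, G, H}" and B': "B' \<in> (`) f ` {F, G, H}"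
    and "A' \<noteq> B'"
    and conn': "\<forall>x\<in>A'. \<forall>y\<in>B'. connected_component (- (path_image (f \<circ> p) \<union> f ` Y)) x y"
    by (elim bexE conjE)
  obtain M where M: "A' = f ` M" "M \<in> {F, G, H}"
    using A' by (rule imageE)
  obtain N where N: "B' = f ` N" "N \<in> {F, G, H}"
    using B' by (rule imageE)
  note MN = M(2) N(2)
  have MN': "M \<in> faces V E" "N \<in> faces V E" using MN faces by auto
  then obtain x y where xy: "x \<in> M" "y \<in> N" using faceD(4) by blast
  \<comment> \<open>The connection found in the plane is pulled back to the sphere by
    \<open>g\<close>.\<close>
  have "homeomorphism (T - X) (- f ` X) f g"
  proof (rule homeomorphism_of_subsets [OF fg])
    show "f ` (T - X) = - f ` X"
      using inj_on_image_set_diff [OF injf, of T X] X fg by (auto simp: homeomorphism_def)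
  qed auto
  then have "homeomorphism (- f ` X) (T - X) g f"
    by (rule homeomorphism_symD)
  moreover have "connected_component (- f ` X) (f x) (f y)"
    using conn' xy by (simp add: M(1) N(1) imJ XJY image_Un)
  ultimately have "connected_component (T - X) (g (f x)) (g (f y))"
    by (rule connected_component_homeomorphismI)
  moreover have "g (f x) = x" "g (f y) = y"
    using fg xy fT [OF MN(1)] fT [OF MN(2)] by (auto simp: homeomorphism_def)
  ultimately have "connected_component (riemann_sphere - X) x y"
    using connected_component_of_subset [of "T - X" x y "riemann_sphere - X"] by (auto simp: T_def)
  then have "M = N"
    using faces_eqI [OF MN' xy] by (simp add: X_def)
  then show False using \<open>A' \<noteq> B'\<close> M(1) N(1) by simp
qed

text \<open>A finite connected set has at most one point. Infinitude allows points of an edge to be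
  chosen off the vertices and off their mirror images.\<close>

lemma embedded_graph_edge_infinite:
  assumes "embedded_graph V E" "e \<in> E"
  shows "infinite e"
proof
  assume "finite e"
  obtain g where g: "simple_path g" "path_image g = e" "e \<inter> V = {pathstart g, pathfinish g}"
    using embedded_graph_edgeE [OF assms] .
  have "connected e"
    using g connected_simple_path_image by blast
  then have "e = {} \<or> (\<exists>a. e = {a})"
    using \<open>finite e\<close> connected_finite_iff_sing [OF \<open>connected e\<close>] by blast
  \<comment> \<open>The parameter \<open>1/2\<close> rather than 1, since the edge may be a
    loop.\<close>
  moreover have "g 0 \<in> e" "g (1/2) \<in> e"
    unfolding g(2) [symmetric] path_image_def by auto
  ultimately have "g 0 = g (1/2)" by auto
  moreover have "loop_free g"
    using g(1) by (simp add: simple_path_def)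
  ultimately have "(0::real) = 1/2 \<or> (0::real) = 0 \<and> 1/2 = (1::real) \<or> (0::real) = 1 \<and> 1/2 = (0::real)"
    unfolding loop_free_def by (elim ballE [of _ _ 0] ballE [of _ _ "1/2"]) simp_all
  then show False by simp
qed

section \<open>Regions of the sphere whose frontier is part of the graph\<close>

locale cycle_region =
  fixes V :: "point set" and E :: "point set set" and M R :: "point set"
  assumes graph: "embedded_graph V E"
    and M: "M \<subseteq> \<Union>E" "M \<noteq> {}"
    and R: "R \<in> components (riemann_sphere - M)"
    and frontier: "top_of_set riemann_sphere frontier_of R = M"
begin

lemma R_subset: "R \<subseteq> riemann_sphere - M" and R_connected: "connected R" and R_nonempty: "R \<noteq> {}"
  using R in_components_subset in_components_connected in_components_nonempty by blast+

lemma M_subset_closure: "M \<subseteq> closure R"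
proof -
  have "top_of_set riemann_sphere closure_of R \<subseteq> closure R"
    by (auto simp: closure_of_subtopology intro: subsetD [OF closure_mono])
  then show ?thesis
    using frontier unfolding frontier_of_def by blast
qed

text \<open>Adjoining the limit point \<open>x\<close> keeps \<open>C\<close> connected, and a
  component absorbs every connected set that meets it.\<close>

lemma connected_subset_R:
  assumes "connected C" "C \<subseteq> riemann_sphere - M" "x \<in> closure C" "x \<in> R"
  shows "C \<subseteq> R"
proof -
  have "connected (insert x C)"
    using assms(1,3) closure_subset [of C]
    by (metis connected_intermediate_closure insert_subset subset_insertI)
  moreover have "insert x C \<subseteq> riemann_sphere - M"
    using assms R_subset by blast
  ultimately have "insert x C \<subseteq> R"
    using components_maximal [OF R] assms(4) by blast
  then show ?thesis by blast
qed

lemma face_subset: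
  assumes "F \<in> faces V E"
  shows "F \<subseteq> riemann_sphere - M"
  using faceD(1,2) [OF assms] M by blast

lemma face_subset_R:
  assumes "F \<in> faces V E" "x \<in> closure F" "x \<in> R"
  shows "F \<subseteq> R"
  using connected_subset_R faceD(3) face_subset assms by blast

text \<open>A limit point of \<open>R\<close> stays on the closed sphere; if it were off
  \<open>M\<close>, it could be adjoined to the component \<open>R\<close>.\<close>

lemma closure_R_Diff: "closure R - R \<subseteq> M"
proof
  fix x assume x: "x \<in> closure R - R"
  have "closure R \<subseteq> riemann_sphere"
    using R_subset by (intro closure_minimal) (auto simp: riemann_sphere_def)
  then have "x \<in> riemann_sphere" using x by blast
  have "connected (insert x R)"
    using x R_connected closure_subset [of R]
    by (metis DiffD1 connected_intermediate_closure insert_subset subset_insertI)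
  show "x \<in> M"
  proof (rule ccontr)
    assume "x \<notin> M"
    then have "insert x R \<subseteq> riemann_sphere - M"
      using R_subset \<open>x \<in> riemann_sphere\<close> by blast
    then have "insert x R \<subseteq> R"
      using components_maximal [OF R \<open>connected (insert x R)\<close>] R_nonempty by blast
    then show False using x by blast
  qed
qed

text \<open>\<open>R\<close> is connected and not a singleton, hence perfect, so deleting finitely
  many points does not affect its closure. A singleton would be closed and would therefore contain
  its nonempty frontier \<open>M\<close>.\<close>

lemma R_subset_closure_Diff:
  assumes "finite W"
  shows "R \<subseteq> closure (R - W)"
proof
  fix x assume "x \<in> R"
  have "R \<noteq> {a}" for a
  proof
    assume "R = {a}"
    then have "M \<subseteq> R" using M_subset_closure by simp
    then show False using R_subset M(2) by blast
  qed
  then have "x islimpt R"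
    using connected_imp_perfect [OF R_connected \<open>x \<in> R\<close>] by blast
  then have "x islimpt (W \<union> (R - W))"
    by (rule islimpt_subset) blast
  then have "x islimpt (R - W)"
    using islimpt_Un_finite [OF assms] by blast
  then show "x \<in> closure (R - W)"
    by (simp add: closure_def)
qed

text \<open>The closures of the finitely many faces inside \<open>R\<close> cover
  \<open>R - V\<close>. Their union is closed, so it also contains the closure of
  \<open>R - V\<close>, which contains \<open>M\<close>.\<close>

lemma face_near_frontier:
  assumes fin: "finite (faces V E)" and col: "alternating_colouring V E A B" and z: "z \<in> M"
  obtains F where "F \<in> faces V E" "F \<subseteq> R" "z \<in> closure F"
proof -
  define \<F> where "\<F> = {F \<in> faces V E. F \<subseteq> R}"
  have "R - V \<subseteq> \<Union>(closure ` \<F>)"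
  proof
    fix x assume x: "x \<in> R - V"
    obtain F where F: "F \<in> faces V E" "x \<in> closure F"
    proof (cases "x \<in> \<Union>E")
      case True
      then obtain e where e: "e \<in> E" "x \<in> e" by blast
      then obtain F G where FG: "{H \<in> faces V E. incident e H} = {F, G}"
        using col unfolding alternating_colouring_def by blast
      have "F \<in> {H \<in> faces V E. incident e H}" by (simp add: FG)
      then show ?thesis using that e by (auto simp: incident_def)
    next
      case False
      then have "x \<in> riemann_sphere - (V \<union> \<Union>E)" using x R_subset by blast
      then have "x \<in> \<Union>(faces V E)" by (simp add: faces_def Union_components)
      then show ?thesis using that closure_subset by blast
    qed
    then show "x \<in> \<Union>(closure ` \<F>)"
      using face_subset_R [of F x] x by (auto simp: \<F>_def)
  qed
  moreover have "closed (\<Union>(closure ` \<F>))"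
    using fin by (auto simp: \<F>_def)
  ultimately have "closure (R - V) \<subseteq> \<Union>(closure ` \<F>)"
    by (rule closure_minimal)
  moreover have "closure R \<subseteq> closure (R - V)"
    using graph by (intro closure_minimal R_subset_closure_Diff) (auto simp: embedded_graph_def)
  ultimately have "z \<in> \<Union>(closure ` \<F>)"
    using z M_subset_closure by blast
  then show ?thesis using that by (auto simp: \<F>_def)
qed

end

section \<open>Reflections that permute the faces\<close>

text \<open>What the counting needs of complex conjugation, in a form that homeomorphisms preserve:
  \<open>fixed_edge\<close> replaces the real line by a pointwise fixed edge at every face. The laws
  for \<open>c\<close> are confined to the sphere, where a transported map is controlled.\<close>

locale face_reflection =
  fixes V :: "point set" and E :: "point set set" and c :: "point \<Rightarrow> point"
  assumes graph: "embedded_graph V E"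
    and finite_faces: "finite (faces V E)" and card_faces: "card (faces V E) > 3"
    and c_sphere: "x \<in> riemann_sphere \<Longrightarrow> c x \<in> riemann_sphere"
    and c_cont: "continuous_on riemann_sphere c"
    and c_c: "x \<in> riemann_sphere \<Longrightarrow> c (c x) = x"
    and c_face: "F \<in> faces V E \<Longrightarrow> c ` F \<in> faces V E"
    and c_face_neq: "F \<in> faces V E \<Longrightarrow> c ` F \<noteq> F"
    and fixed_edge: "F \<in> faces V E \<Longrightarrow> \<exists>e\<in>E. incident e F \<and> (\<forall>x\<in>e. c x = x)"
begin

lemma c_c_face: "F \<in> faces V E \<Longrightarrow> c ` c ` F = F"
  using c_c faceD(1) by (force simp: image_image)

lemma edge_subset: "e \<in> E \<Longrightarrow> e \<subseteq> riemann_sphere"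
  using graph by (simp add: embedded_graph_def)

lemma closure_c:
  assumes "F \<in> faces V E" "z \<in> closure F" "z \<in> riemann_sphere"
  shows "c z \<in> closure (c ` F)"
  using closure_image_continuous [OF c_cont faceD(1)] assms by blast

text \<open>The reflection carries the closure of \<open>F\<close> into that of its mirror image and
  leaves the edge in place.\<close>

lemma fixed_edge_both:
  assumes "F \<in> faces V E"
  obtains e where "e \<in> E" "incident e F" "incident e (c ` F)"
proof -
  obtain e where e: "e \<in> E" "incident e F" "\<forall>x\<in>e. c x = x"
    using fixed_edge [OF assms] by blast
  moreover have "incident e (c ` F)"
    using closure_c [OF assms] e edge_subset [OF e(1)] unfolding incident_def by (metis subset_iff)
  ultimately show ?thesis using that by blast
qed

text \<open>\<open>F\<close> and its mirror image are distinct and share a fixed edge, and the two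
  faces incident to an edge have different colours.\<close>

lemma c_swaps_colours:
  assumes col: "alternating_colouring V E A B" and F: "F \<in> faces V E"
  shows "c ` F \<in> A \<longleftrightarrow> F \<in> B" "c ` F \<in> B \<longleftrightarrow> F \<in> A"
proof -
  obtain e where e: "e \<in> E" "incident e F" "incident e (c ` F)"
    using fixed_edge_both [OF F] .
  obtain F' G' where FG: "F' \<in> A" "G' \<in> B" "{H \<in> faces V E. incident e H} = {F', G'}"
    using col e(1) unfolding alternating_colouring_def by blast
  have "F \<in> {F', G'}" "c ` F \<in> {F', G'}"
    using e F c_face [OF F] unfolding FG(3) [symmetric] by auto
  moreover have "F' \<notin> B" "G' \<notin> A"
    using FG(1,2) col unfolding alternating_colouring_def by blast+
  ultimately show "c ` F \<in> A \<longleftrightarrow> F \<in> B" "c ` F \<in> B \<longleftrightarrow> F \<in> A"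
    using FG(1,2) c_face_neq [OF F] by auto
qed

text \<open>Positivity constrains faces incident to a whole edge of the cycle;
  \<open>incident_if_touches_cycle_edge\<close> extends it to faces that merely touch the cycle at a
  point other than a vertex.\<close>

lemma interior_face_at_cycle:
  assumes col: "alternating_colouring V E A B"
    and L: "positive_multicycle V E A L" "interior_region L R"
    and z: "z \<in> (\<Union>p\<in>L. path_image p) - V"
    and F: "F \<in> faces V E" "F \<subseteq> R" "z \<in> closure F"
  shows "F \<in> A"
proof -
  obtain p where p: "p \<in> L" "z \<in> path_image p" "z \<notin> V"
    using z by blast
  have pos: "positive_cycle V E A p" and left: "R \<subseteq> left_side p"
    using L p(1) by (auto simp: positive_multicycle_def interior_region_def)
  then have sp: "simple_path p" "pathfinish p = pathstart p" and "\<exists>C\<subseteq>E. path_image p = \<Union>C"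
    by (auto simp: positive_cycle_def oriented_cycle_def)
  then obtain C e where C: "C \<subseteq> E" "path_image p = \<Union>C" "e \<in> C" "z \<in> e"
    using p(2) by blast
  have e: "e \<in> E" "e \<subseteq> path_image p" "path_image p \<subseteq> \<Union>E"
    using C by blast+
  then have "incident e F"
    using incident_if_touches_cycle_edge [OF graph col card_faces sp e(3,1,2) _ F(1,3)] C(4) p(3)
    by blast
  moreover have "F \<subseteq> left_side p" using F(2) left by blast
  ultimately show ?thesis
    using pos e F(1) unfolding positive_cycle_def by blast
qed

lemma interior_balance:
  assumes col: "alternating_colouring V E A B"
    and L: "positive_multicycle V E A L" "interior_region L R"
  shows "card {F \<in> B. F \<subseteq> R} < card {F \<in> A. F \<subseteq> R}"
proof -
  define M where "M = (\<Union>p\<in>L. path_image p)"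
  have bounded: "bounded_region L R" and cobordant: "cobordant_multicycle E L"
    using L by (simp_all add: interior_region_def positive_multicycle_def)
  have cyc: "\<exists>C\<subseteq>E. path_image p = \<Union>C" "simple_path p" if "p \<in> L" for p
    using cobordant that by (auto simp: cobordant_multicycle_def oriented_cycle_def)
  \<comment> \<open>The multicycle disconnects the connected sphere, so it is nonempty and
    contributes an edge \<open>e\<close> of the graph.\<close>
  have "connected riemann_sphere"
    unfolding riemann_sphere_def by (rule connected_sphere) simp
  then have "L \<noteq> {}"
    using cobordant by (auto simp: cobordant_multicycle_def)
  then obtain p where p: "p \<in> L" by blast
  obtain C where C: "C \<subseteq> E" "path_image p = \<Union>C" using cyc(1) [OF p] by blast
  moreover have "path_image p \<noteq> {}" by simp
  ultimately obtain e where e: "e \<in> C" "e \<in> E" by blast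
  have "e \<subseteq> M" using p C e by (auto simp: M_def)
  have "path_image p \<subseteq> \<Union>E" if "p \<in> L" for p
    using cyc(1) [OF that] by (elim exE conjE) (simp add: Union_mono)
  then have "M \<subseteq> \<Union>E"
    unfolding M_def by (rule UN_least)
  moreover have "M \<noteq> {}"
    using \<open>e \<subseteq> M\<close> embedded_graph_edge_infinite [OF graph e(2)] by auto
  ultimately have M: "M \<subseteq> \<Union>E" "M \<noteq> {}" by simp_all
  interpret cycle_region V E M R
    by standard (use graph M bounded in \<open>simp_all add: bounded_region_def M_def\<close>)
  have AB: "A \<union> B = faces V E" "A \<inter> B = {}"
    using col by (simp_all add: alternating_colouring_def)
  have at_cycle: "F \<in> A" if "F \<in> faces V E" "F \<subseteq> R" "z \<in> closure F" "z \<in> M" "z \<notin> V" for F z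
    using interior_face_at_cycle [OF col L _ that(1-3)] that(4,5) by (simp add: M_def)
  have finV: "finite V" using graph by (simp add: embedded_graph_def)
  have B_to_A: "c ` F \<in> {F \<in> A. F \<subseteq> R}" if "F \<in> {F \<in> B. F \<subseteq> R}" for F
  proof -
    have F: "F \<in> faces V E" "F \<in> B" "F \<subseteq> R" using that AB by blast+
    have "c ` F \<subseteq> R"
    proof (rule ccontr)
      assume out: "\<not> c ` F \<subseteq> R"
      \<comment> \<open>A non-vertex point \<open>z\<close> of the fixed edge is a limit of both
        faces. If \<open>z\<close> were in \<open>R\<close>, the mirror image would be in
        \<open>R\<close> too; hence \<open>z\<close> is on \<open>M\<close>, where a
        \<open>B\<close>-face of \<open>R\<close> cannot reach.\<close>
      obtain e where e: "e \<in> E" "incident e F" "incident e (c ` F)"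
        using fixed_edge_both [OF F(1)] .
      have "\<not> e \<subseteq> V"
        using embedded_graph_edge_infinite [OF graph e(1)] finV finite_subset by blast
      then obtain z where z: "z \<in> e" "z \<notin> V" by blast
      have zc: "z \<in> closure F" "z \<in> closure (c ` F)" using e z by (auto simp: incident_def)
      then have "z \<notin> R"
        using out face_subset_R [OF c_face [OF F(1)]] by blast
      moreover have "z \<in> closure R" using zc(1) closure_mono [OF F(3)] by blast
      ultimately have "z \<in> M" using closure_R_Diff by blast
      then have "F \<in> A" using at_cycle [OF F(1,3) zc(1)] z by blast
      then show False using F(2) AB by blast
    qed
    then show ?thesis using c_swaps_colours(1) [OF col F(1)] F(2) by blast
  qed
  have sub: "(`) c ` {F \<in> B. F \<subseteq> R} \<subseteq> {F \<in> A. F \<subseteq> R}"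
    using B_to_A by blast
  moreover have "(`) c ` {F \<in> B. F \<subseteq> R} \<noteq> {F \<in> A. F \<subseteq> R}"
  proof
    assume eq: "(`) c ` {F \<in> B. F \<subseteq> R} = {F \<in> A. F \<subseteq> R}"
    \<comment> \<open>If the injection is onto, the involution \<open>c\<close> sends the
      \<open>A\<close>-faces of \<open>R\<close> back to \<open>B\<close>-faces of
      \<open>R\<close>.\<close>
    have A_to_B: "c ` F \<in> B \<and> c ` F \<subseteq> R" if "F \<in> A" "F \<subseteq> R" for F
    proof -
      have "F \<in> (`) c ` {F \<in> B. F \<subseteq> R}" using that eq by simp
      then obtain G where G: "F = c ` G" "G \<in> {F \<in> B. F \<subseteq> R}" by (rule imageE)
      then have "c ` F = G" using c_c_face [of G] AB by blast
      then show ?thesis using G(2) by blast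
    qed
    \<comment> \<open>Avoiding both finite sets makes \<open>z\<close> and \<open>c z\<close>
      non-vertices, so \<open>at_cycle\<close> applies at both points.\<close>
    have "\<not> e \<subseteq> V \<union> c ` V"
      using embedded_graph_edge_infinite [OF graph e(2)] finV finite_subset by blast
    then obtain z where z: "z \<in> e" "z \<notin> V" "z \<notin> c ` V" by blast
    have zS: "z \<in> riemann_sphere" using z(1) edge_subset [OF e(2)] by blast
    then have cz: "c z \<notin> V" using z(3) c_c by (metis imageI)
    have zM: "z \<in> M" using z(1) \<open>e \<subseteq> M\<close> by blast
    obtain F where F: "F \<in> faces V E" "F \<subseteq> R" "z \<in> closure F"
      using face_near_frontier [OF finite_faces col zM] .
    have FA: "F \<in> A" using at_cycle [OF F zM z(2)] .
    obtain F' G where FG: "F' \<in> A" "G \<in> B" "{H \<in> faces V E. incident e H} = {F', G}"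
      using col e(2) unfolding alternating_colouring_def by blast
    have "G \<in> {H \<in> faces V E. incident e H}" by (simp add: FG(3))
    then have G: "G \<in> faces V E" "z \<in> closure G"
      using z(1) by (auto simp: incident_def)
    have "\<not> G \<subseteq> R"
      using at_cycle [OF G(1) _ G(2) zM z(2)] FG(2) AB by blast
    \<comment> \<open>The mirror image of \<open>G\<close> is an \<open>A\<close>-face; inside
      \<open>R\<close> it would be reflected back into \<open>R\<close> by \<open>A_to_B\<close>,
      but \<open>G\<close> is outside.\<close>
    have "\<not> c ` G \<subseteq> R"
    proof
      assume "c ` G \<subseteq> R"
      moreover have "c ` G \<in> A" using c_swaps_colours(1) [OF col G(1)] FG(2) by blast
      ultimately have "c ` c ` G \<subseteq> R" using A_to_B by blast
      then show False using c_c_face [OF G(1)] \<open>\<not> G \<subseteq> R\<close> by simp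
    qed
    then have "c z \<notin> R"
      using face_subset_R [OF c_face [OF G(1)] closure_c [OF G zS]] by blast
    have cF: "c ` F \<in> B" "c ` F \<subseteq> R" using A_to_B [OF FA F(2)] by auto
    \<comment> \<open>Now \<open>c z\<close> is a limit point of \<open>R\<close> outside
      \<open>R\<close>, hence on \<open>M\<close>, and the \<open>B\<close>-face \<open>c F\<close>
      of \<open>R\<close> touches it there.\<close>
    have czF: "c z \<in> closure (c ` F)" using closure_c [OF F(1,3) zS] .
    then have "c z \<in> closure R" using closure_mono [OF cF(2)] by blast
    then have "c z \<in> M" using \<open>c z \<notin> R\<close> closure_R_Diff by blast
    then have "c ` F \<in> A" using at_cycle [OF c_face [OF F(1)] cF(2) czF _ cz] by blast
    then show False using cF(1) AB by blast
  qed
  ultimately have "(`) c ` {F \<in> B. F \<subseteq> R} \<subset> {F \<in> A. F \<subseteq> R}" by blast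
  moreover have "finite {F \<in> A. F \<subseteq> R}"
    using finite_faces AB(1) by (auto intro: finite_subset)
  ultimately have "card ((`) c ` {F \<in> B. F \<subseteq> R}) < card {F \<in> A. F \<subseteq> R}"
    by (intro psubset_card_mono)
  moreover have "inj_on ((`) c) {F \<in> B. F \<subseteq> R}"
    using AB(1) c_c_face by (intro inj_on_inverseI [where g = "(`) c"]) blast
  ultimately show ?thesis by (simp add: card_image)
qed

end

section \<open>Transport along a homeomorphism of the sphere\<close>

lemma components_homeomorphism:
  assumes "homeomorphism S T f g"
  shows "components T = (`) f ` components S"
proof -
  have "T = f ` S" using assms by (simp add: homeomorphism_def)
  then have "components T = (\<lambda>x. connected_component_set T (f x)) ` S"
    by (simp add: components_def image_image)
  also have "\<dots> = (\<lambda>x. f ` connected_component_set S x) ` S"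
    using connected_component_set_homeomorphism [OF assms] by simp
  finally show ?thesis by (simp add: components_def image_image)
qed

locale transported_graph =
  fixes V :: "point set" and E :: "point set set" and f g :: "point \<Rightarrow> point"
  assumes graph: "embedded_graph V E"
    and homeo: "homeomorphism riemann_sphere riemann_sphere f g"
begin

abbreviation "V' \<equiv> f ` V"
abbreviation "E' \<equiv> (`) f ` E"

lemma V_subset: "V \<subseteq> riemann_sphere"
  using graph by (simp add: embedded_graph_def)

lemma E_subset: "e \<in> E \<Longrightarrow> e \<subseteq> riemann_sphere"
  using graph by (simp add: embedded_graph_def)

lemma cont_f: "continuous_on riemann_sphere f" and cont_g: "continuous_on riemann_sphere g"
  and f_sphere: "f ` riemann_sphere = riemann_sphere" and g_sphere: "g ` riemann_sphere = riemann_sphere"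
  and g_f: "x \<in> riemann_sphere \<Longrightarrow> g (f x) = x" and f_g: "x \<in> riemann_sphere \<Longrightarrow> f (g x) = x"
  using homeo by (simp_all add: homeomorphism_def)

lemma inj_f: "inj_on f riemann_sphere"
  using g_f by (rule inj_on_inverseI)

lemma g_f_image: "X \<subseteq> riemann_sphere \<Longrightarrow> g ` f ` X = X"
  using g_f by (force simp: image_image)

text \<open>Injectivity on sets of points lets cardinalities of families of faces be
  transported.\<close>

lemma inj_image_f: "inj_on ((`) f) (Pow riemann_sphere)"
  using g_f_image by (intro inj_on_inverseI [where g = "(`) g"]) blast

lemma faces_subset: "faces V E \<subseteq> Pow riemann_sphere"
  using faceD(1) by blast

lemma homeo_complement:
  "homeomorphism (riemann_sphere - (V \<union> \<Union>E)) (riemann_sphere - (V' \<union> \<Union>E')) f g"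
proof (rule homeomorphism_of_subsets [OF homeo])
  have "V \<union> \<Union>E \<subseteq> riemann_sphere"
    using V_subset E_subset by blast
  then have "f ` (riemann_sphere - (V \<union> \<Union>E)) = riemann_sphere - f ` (V \<union> \<Union>E)"
    using inj_on_image_set_diff [OF inj_f, of riemann_sphere "V \<union> \<Union>E"] f_sphere by simp
  then show "f ` (riemann_sphere - (V \<union> \<Union>E)) = riemann_sphere - (V' \<union> \<Union>E')"
    by (simp add: image_Un image_Union)
qed auto

lemma faces_image: "faces V' E' = (`) f ` faces V E"
  unfolding faces_def by (rule components_homeomorphism [OF homeo_complement])

lemma card_faces_image: "card (faces V' E') = card (faces V E)"
  unfolding faces_image by (intro card_image inj_on_subset [OF inj_image_f] faces_subset)

text \<open>Limit points on the sphere are preserved by \<open>f\<close> and, for the converse, by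
  its inverse \<open>g\<close>.\<close>

lemma incident_image:
  assumes "e \<subseteq> riemann_sphere" "F \<subseteq> riemann_sphere"
  shows "incident (f ` e) (f ` F) \<longleftrightarrow> incident e F"
proof
  assume "incident e F"
  then show "incident (f ` e) (f ` F)"
    using closure_image_continuous [OF cont_f assms(2)] assms(1) unfolding incident_def by blast
next
  assume inc: "incident (f ` e) (f ` F)"
  show "incident e F"
    unfolding incident_def
  proof
    fix x assume "x \<in> e"
    then have x: "x \<in> riemann_sphere" "f x \<in> closure (f ` F)"
      using inc assms(1) by (auto simp: incident_def)
    have sub: "f ` F \<subseteq> riemann_sphere" "f x \<in> riemann_sphere"
      using assms(2) x(1) f_sphere by blast+
    have "g (f x) \<in> closure (g ` f ` F)"
      by (rule closure_image_continuous [OF cont_g sub x(2)])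
    then show "x \<in> closure F"
      by (simp add: g_f [OF x(1)] g_f_image [OF assms(2)])
  qed
qed

lemma incident_faces_image:
  assumes "e \<in> E"
  shows "{H \<in> faces V' E'. incident (f ` e) H} = (`) f ` {H \<in> faces V E. incident e H}"
  using incident_image [OF E_subset [OF assms] faceD(1)] unfolding faces_image by blast

lemma embedded_graph_image: "embedded_graph V' E'"
  unfolding embedded_graph_def
proof (intro conjI ballI impI)
  show "finite V'" "finite E'" using graph by (simp_all add: embedded_graph_def)
  show "V' \<subseteq> riemann_sphere" using V_subset f_sphere by blast
  fix e' assume "e' \<in> E'"
  then obtain e where e: "e' = f ` e" "e \<in> E" by (rule imageE)
  note eS = E_subset [OF e(2)]
  show "e' \<subseteq> riemann_sphere" using eS f_sphere e(1) by blast
  obtain k where k: "simple_path k" "path_image k = e" "e \<inter> V = {pathstart k, pathfinish k}"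
    using embedded_graph_edgeE [OF graph e(2)] .
  have "simple_path (f \<circ> k)"
    using k(1)
  proof (rule simple_path_continuous_image)
    show "continuous_on (path_image k) f"
      unfolding k(2) by (rule continuous_on_subset [OF cont_f eS])
    show "inj_on f (path_image k)"
      unfolding k(2) by (rule inj_on_subset [OF inj_f eS])
  qed
  moreover have "path_image (f \<circ> k) = e'"
    by (simp add: path_image_compose k(2) e(1))
  moreover have "e' \<inter> V' = {pathstart (f \<circ> k), pathfinish (f \<circ> k)}"
    using inj_on_image_Int [OF inj_f eS V_subset]
    by (simp add: e(1) k(3) pathstart_compose pathfinish_compose)
  ultimately show "\<exists>k. simple_path k \<and> path_image k = e' \<and> e' \<inter> V' = {pathstart k, pathfinish k}"
    by blast
  fix h' assume "h' \<in> E'" "e' \<noteq> h'"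
  then obtain h where h: "h' = f ` h" "h \<in> E" by blast
  then have "e \<inter> h \<subseteq> V"
    using embedded_graph_edges_meet [OF graph e(2) h(2)] e(1) \<open>e' \<noteq> h'\<close> by blast
  then show "e' \<inter> h' \<subseteq> V'"
    unfolding e(1) h(1) inj_on_image_Int [OF inj_f eS E_subset [OF h(2)], symmetric]
    by (rule image_mono)
qed

lemma simply_connected_face_image:
  assumes "F \<in> faces V E" "simply_connected F"
  shows "simply_connected (f ` F)"
proof -
  have "homeomorphism F (f ` F) f g"
    using faceD(1) [OF assms(1)] f_sphere by (intro homeomorphism_of_subsets [OF homeo]) auto
  then show ?thesis
    using assms(2) homeomorphic_simply_connected by (meson homeomorphic_def)
qed

lemma alternating_colouring_image:
  assumes "alternating_colouring V E A B"
  shows "alternating_colouring V' E' ((`) f ` A) ((`) f ` B)"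
  unfolding alternating_colouring_def
proof (intro conjI ballI)
  have AB: "A \<union> B = faces V E" "A \<inter> B = {}"
    using assms by (simp_all add: alternating_colouring_def)
  show "(`) f ` A \<union> (`) f ` B = faces V' E'"
    by (simp add: faces_image AB flip: image_Un)
  have "(`) f ` A \<inter> (`) f ` B = (`) f ` (A \<inter> B)"
    using AB(1) faces_subset by (intro inj_on_image_Int [OF inj_image_f, symmetric]) blast+
  then show "(`) f ` A \<inter> (`) f ` B = {}" using AB(2) by simp
  fix e' assume "e' \<in> E'"
  then obtain e where e: "e' = f ` e" "e \<in> E" by (rule imageE)
  obtain F G where FG: "F \<in> A" "G \<in> B" "{H \<in> faces V E. incident e H} = {F, G}"
    using assms e(2) unfolding alternating_colouring_def by blast
  have "{H \<in> faces V' E'. incident e' H} = {f ` F, f ` G}"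
    unfolding e(1) incident_faces_image [OF e(2)] FG(3) by simp
  then show "\<exists>F\<in>(`) f ` A. \<exists>G\<in>(`) f ` B. {H \<in> faces V' E'. incident e' H} = {F, G}"
    using FG(1,2) by blast
qed

lemma globally_balanced_image:
  assumes "globally_balanced d V E"
  shows "globally_balanced d V' E'"
proof -
  have fin: "finite (faces V E)" and sc: "\<And>F. F \<in> faces V E \<Longrightarrow> simply_connected F"
    using assms by (simp_all add: globally_balanced_def cellularly_embedded_def)
  have "cellularly_embedded V' E'"
    unfolding cellularly_embedded_def
    using embedded_graph_image fin sc simply_connected_face_image by (auto simp: faces_image)
  moreover obtain A B where AB: "alternating_colouring V E A B" "card A = d" "card B = d"
    using assms by (auto simp: globally_balanced_def)
  moreover have "A \<union> B = faces V E"
    using AB(1) by (simp add: alternating_colouring_def)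
  then have "A \<subseteq> Pow riemann_sphere" "B \<subseteq> Pow riemann_sphere"
    using faces_subset by blast+
  then have "card ((`) f ` A) = card A" "card ((`) f ` B) = card B"
    by (simp_all add: card_image inj_on_subset [OF inj_image_f])
  ultimately show ?thesis
    using assms alternating_colouring_image [OF AB(1)] card_faces_image
    unfolding globally_balanced_def by auto
qed

text \<open>Conjugating the reflection by the homeomorphism carries its fixed edges and its action
  on faces to the image graph.\<close>

lemma face_reflection_image:
  assumes "face_reflection V E c"
  shows "face_reflection V' E' (f \<circ> c \<circ> g)"
proof -
  interpret face_reflection V E c by (rule assms)
  have image: "(f \<circ> c \<circ> g) ` f ` X = f ` c ` X" if "X \<subseteq> riemann_sphere" for X
    using g_f_image [OF that] by (metis image_comp)
  have g_in: "g x \<in> riemann_sphere" if "x \<in> riemann_sphere" for x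
    using that g_sphere by blast
  have f_in: "f x \<in> riemann_sphere" if "x \<in> riemann_sphere" for x
    using that f_sphere by blast
  show ?thesis
  proof
    show "embedded_graph V' E'" by (rule embedded_graph_image)
    show "finite (faces V' E')" using finite_faces by (simp add: faces_image)
    show "3 < card (faces V' E')" using card_faces by (simp add: card_faces_image)
    show "(f \<circ> c \<circ> g) x \<in> riemann_sphere" if "x \<in> riemann_sphere" for x
      using that by (simp add: f_in c_sphere g_in)
    show "(f \<circ> c \<circ> g) ((f \<circ> c \<circ> g) x) = x" if "x \<in> riemann_sphere" for x
      using that by (simp add: g_f c_sphere g_in c_c f_g)
    show "continuous_on riemann_sphere (f \<circ> c \<circ> g)"
      using cont_f cont_g c_cont c_sphere g_sphere
      by (intro continuous_on_compose) (auto intro: continuous_on_subset)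
  next
    fix F' assume "F' \<in> faces V' E'"
    then obtain F where F: "F' = f ` F" "F \<in> faces V E"
      unfolding faces_image by (rule imageE)
    note FS = faceD(1) [OF F(2)] and cFS = faceD(1) [OF c_face [OF F(2)]]
    show "(f \<circ> c \<circ> g) ` F' \<in> faces V' E'"
      unfolding F(1) image [OF FS] faces_image using c_face [OF F(2)] by blast
    show "(f \<circ> c \<circ> g) ` F' \<noteq> F'"
      unfolding F(1) image [OF FS]
      using c_face_neq [OF F(2)] g_f_image [OF FS] g_f_image [OF cFS] by metis
    obtain e where e: "e \<in> E" "incident e F" "\<forall>x\<in>e. c x = x"
      using fixed_edge [OF F(2)] by blast
    have "incident (f ` e) F'"
      using incident_image [OF E_subset [OF e(1)] FS] e(2) by (simp add: F(1))
    moreover have "\<forall>x\<in>f ` e. (f \<circ> c \<circ> g) x = x"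
      using e(3) g_f E_subset [OF e(1)] by (auto simp: subset_iff)
    ultimately show "\<exists>e\<in>E'. incident e F' \<and> (\<forall>x\<in>e. (f \<circ> c \<circ> g) x = x)"
      using e(1) by blast
  qed
qed

end

section \<open>Complex conjugation\<close>

lemma conj_point_sphere: "x \<in> riemann_sphere \<Longrightarrow> conj_point x \<in> riemann_sphere"
  by (cases x) (simp add: riemann_sphere_def conj_point_def norm_prod_def)

text \<open>The imaginary part of the first coordinate changes sign under conjugation. On an
  invariant connected set it therefore takes the value 0, which puts a point of the set on the real
  line.\<close>

lemma conj_point_face_neq:
  assumes "connected F" "F \<noteq> {}" "F \<subseteq> riemann_sphere - real_line"
  shows "conj_point ` F \<noteq> F"
proof
  assume eq: "conj_point ` F = F"
  obtain x where x: "x \<in> F" using assms(2) by blast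
  define h where "h = (\<lambda>y :: point. Im (fst y))"
  have "continuous_on F h"
    unfolding h_def by (intro continuous_intros)
  then have conn: "connected (h ` F)"
    by (rule connected_continuous_image [OF _ assms(1)])
  have "conj_point x \<in> F" using x eq by blast
  then have "- h x \<in> h ` F"
    by (rule rev_image_eqI) (simp add: h_def conj_point_def case_prod_unfold)
  moreover have "h x \<in> h ` F" using x by blast
  ultimately have "0 \<in> h ` F"
    using connected_contains_Icc [OF conn, of "h x" "- h x"] connected_contains_Icc [OF conn, of "- h x" "h x"]
    by (cases "h x \<le> 0") (auto simp: subset_iff)
  then obtain y where "y \<in> F" "Im (fst y) = 0"
    by (auto simp: h_def)
  then have "y \<in> real_line"
    using assms(3) by (cases y) (auto simp: real_line_def)
  then show False
    using \<open>y \<in> F\<close> assms(3) by blast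
qed

lemma real_gb_standard_face_reflection:
  assumes "real_gb_standard d V E"
  shows "face_reflection V E conj_point"
proof
  have gb: "globally_balanced d V E"
    using assms by (simp add: real_gb_standard_def)
  \<comment> \<open>The bound on the number of faces comes from \<open>2 * d\<close> with
    \<open>d \<ge> 2\<close>.\<close>
  then show "embedded_graph V E" "finite (faces V E)" "3 < card (faces V E)"
    by (simp_all add: globally_balanced_def cellularly_embedded_def)
  show "conj_point x \<in> riemann_sphere" if "x \<in> riemann_sphere" for x
    using that by (rule conj_point_sphere)
  show "continuous_on riemann_sphere conj_point"
    unfolding conj_point_def case_prod_unfold by (intro continuous_intros)
  show "conj_point (conj_point x) = x" for x
    by (simp add: conj_point_def case_prod_unfold)
  fix F assume F: "F \<in> faces V E"
  have conj: "(\<lambda>F. conj_point ` F) ` faces V E = faces V E"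
    and edge: "\<forall>F\<in>faces V E. \<exists>e\<in>E. e \<subseteq> real_line \<and> incident e F"
    using assms by (simp_all add: real_gb_standard_def)
  show "conj_point ` F \<in> faces V E"
    using conj F by blast
  obtain C where "C \<subseteq> E" "\<Union>C = real_line"
    using assms by (auto simp: real_gb_standard_def)
  then have "real_line \<subseteq> \<Union>E" by blast
  then have "F \<subseteq> riemann_sphere - real_line"
    using faceD(1,2) [OF F] by blast
  then show "conj_point ` F \<noteq> F"
    by (rule conj_point_face_neq [OF faceD(3,4) [OF F]])
  obtain e where e: "e \<in> E" "e \<subseteq> real_line" "incident e F"
    using edge F by blast
  have "conj_point x = x" if "x \<in> real_line" for x
    using that by (auto simp: real_line_def conj_point_def complex_eq_iff)
  then show "\<exists>e\<in>E. incident e F \<and> (\<forall>x\<in>e. conj_point x = x)"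
    using e by blast
qed

theorem corollary5:
  fixes d :: nat and V :: "point set" and E :: "point set set"
  assumes "real_gb_graph d V E"
  shows "locally_balanced V E"
proof -
  obtain V0 E0 where std: "real_gb_standard d V0 E0" and "ambient_isotopic V0 E0 V E"
    using assms by (auto simp: real_gb_graph_def)
  then obtain h :: "real \<times> point \<Rightarrow> point"
    where h: "\<forall>s\<in>{0..1}. \<exists>g. homeomorphism riemann_sphere riemann_sphere (\<lambda>x. h (s, x)) g"
      and V: "V = (\<lambda>x. h (1, x)) ` V0" and E: "E = (`) (\<lambda>x. h (1, x)) ` E0"
    unfolding ambient_isotopic_def by blast
  \<comment> \<open>The time-1 map of the isotopy is a homeomorphism of the sphere taking the
    standard graph to the given one; conjugation is transported along it.\<close>
  obtain g where g: "homeomorphism riemann_sphere riemann_sphere (\<lambda>x. h (1, x)) g"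
    using h by force
  have gb: "globally_balanced d V0 E0" using std by (simp add: real_gb_standard_def)
  interpret transported_graph V0 E0 "\<lambda>x. h (1, x)" g
    using g gb by unfold_locales (simp_all add: globally_balanced_def cellularly_embedded_def)
  interpret face_reflection V E "(\<lambda>x. h (1, x)) \<circ> conj_point \<circ> g"
    unfolding V E by (rule face_reflection_image [OF real_gb_standard_face_reflection [OF std]])
  have "globally_balanced d V E"
    unfolding V E by (rule globally_balanced_image [OF gb])
  then show ?thesis
    unfolding locally_balanced_def using interior_balance by blast
qed

end
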